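(* Let $\mathcal{H}$ be a complex Hilbert space and let $T\in\mathcal{B}(\mathcal{H})$ be a contractive $m$-quasi-isometry, for an integer $m\ge3$, which satisfies $|T|\le|\mathrm{Re}\,T|$. Then $$\mathcal{N}(I-T^*T)=\mathcal{N}(I-TT^* )=\overline{\mathcal{R}(T^m)},$$ and this subspace reduces $T$ to a symmetry $S:=T|_{\overline{\mathcal{R}(T^m)}}$. In addition, $T$ is self-adjoint if and only if $T=S\oplus0$ with respect to the decomposition $\mathcal{H}=\overline{\mathcal{R}(T^m)}\oplus\mathcal{N}(T^{*m})$.
   Context: $\mathcal{B}(\mathcal{H})$ is the algebra of bounded linear operators on $\mathcal{H}$; $\mathcal{N}(\cdot)$ and $\mathcal{R}(\cdot)$ denote null-space and range, $I$ the identity. Contractive means norm at most $1$. $T$ is an $m$-quasi-isometry if $T|_{\mathcal{R}(T^m)}$ is an isometry, i.e. $\|Tx\|=\|x\|$ for all $x\in\mathcal{R}(T^m)$. $|T|=(T^*T)^{1/2}$ and $\mathrm{Re}\,T=\frac12(T+T^* )$; inequalities between self-adjoint operators are in the usual order. A symmetry is a unitary operator $U$ with $U^*=U$. A closed subspace $\mathcal{G}$ reduces $T$ to a symmetry if $T\mathcal{G}\subset\mathcal{G}$, $T^*\mathcal{G}\subset\mathcal{G}$ and $T|_{\mathcal{G}}$ is a symmetry on $\mathcal{G}$. *)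

theory Defs
  imports "HOL-Analysis.Analysis"
begin

text \<open>
  The inner product is linear in its first argument. Real scalar multiplication, norm, metric and
  topology come from \<^class>\<open>real_normed_vector\<close>; the last axiom says that the norm is the one
  induced by the inner product.
\<close>

class complex_inner = real_normed_vector +
  fixes scaleC :: "complex \<Rightarrow> 'a \<Rightarrow> 'a"  (infixr "*\<^sub>C" 75)
    and cinner :: "'a \<Rightarrow> 'a \<Rightarrow> complex"
  assumes scaleC_add_right: "c *\<^sub>C (x + y) = c *\<^sub>C x + c *\<^sub>C y"
    and scaleC_add_left: "(c + d) *\<^sub>C x = c *\<^sub>C x + d *\<^sub>C x"
    and scaleC_scaleC: "c *\<^sub>C (d *\<^sub>C x) = (c * d) *\<^sub>C x"
    and scaleC_of_real: "complex_of_real r *\<^sub>C x = r *\<^sub>R x"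
    and cinner_add_left: "cinner (x + y) z = cinner x z + cinner y z"
    and cinner_scaleC_left: "cinner (c *\<^sub>C x) y = c * cinner x y"
    and cinner_commute: "cinner x y = cnj (cinner y x)"
    and cinner_self: "cinner x x = complex_of_real ((norm x)\<^sup>2)"

class chilbert_space = complex_inner + complete_space

instantiation complex :: chilbert_space
begin
definition "scaleC c x = c * x" for c x :: complex
definition "cinner x y = x * cnj y" for x y :: complex
instance
proof
  show "cinner x x = complex_of_real ((norm x)\<^sup>2)" for x :: complex
    unfolding cinner_complex_def by (rule complex_norm_square [symmetric])
qed (simp_all add: scaleC_complex_def cinner_complex_def scaleR_conv_of_real distrib_left
       distrib_right mult.commute)
end

definition csubspace :: "'a::complex_inner set \<Rightarrow> bool" where
  "csubspace G \<longleftrightarrow> 0 \<in> G \<and> (\<forall>x\<in>G. \<forall>y\<in>G. x + y \<in> G) \<and> (\<forall>c. \<forall>x\<in>G. c *\<^sub>C x \<in> G)"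

text \<open>
  The algebra of bounded linear operators on the Hilbert space \<open>G\<close>, where \<open>G\<close> is a closed subspace
  of the ambient type (possibly \<^const>\<open>UNIV\<close>). An operator on \<open>G\<close> is represented by a function that
  is \<^const>\<open>undefined\<close> outside \<open>G\<close>, so that equality of operators on \<open>G\<close> is equality of functions
  and the restriction of \<open>T\<close> to \<open>G\<close> is \<^term>\<open>restrict T G\<close>.
\<close>

definition bounded_ops :: "'a::complex_inner set \<Rightarrow> ('a \<Rightarrow> 'a) set" where
  "bounded_ops G = {A \<in> G \<rightarrow>\<^sub>E G.
     (\<forall>x\<in>G. \<forall>y\<in>G. A (x + y) = A x + A y) \<and>
     (\<forall>c. \<forall>x\<in>G. A (c *\<^sub>C x) = c *\<^sub>C A x) \<and>
     (\<exists>K. \<forall>x\<in>G. norm (A x) \<le> norm x * K)}"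

lemma bounded_ops_UNIV_iff:
  "A \<in> bounded_ops UNIV \<longleftrightarrow> bounded_linear A \<and> (\<forall>c x. A (c *\<^sub>C x) = c *\<^sub>C A x)"
  unfolding bounded_ops_def bounded_linear_def linear_iff bounded_linear_axioms_def
  by (simp add: PiE_def extensional_def scaleC_of_real [symmetric]) blast

definition adj_on :: "'a::complex_inner set \<Rightarrow> ('a \<Rightarrow> 'a) \<Rightarrow> 'a \<Rightarrow> 'a" where
  "adj_on G A = (THE B. B \<in> bounded_ops G \<and> (\<forall>x\<in>G. \<forall>y\<in>G. cinner (A x) y = cinner x (B y)))"

abbreviation adj :: "('a::complex_inner \<Rightarrow> 'a) \<Rightarrow> 'a \<Rightarrow> 'a" where
  "adj \<equiv> adj_on UNIV"

definition unitary_on :: "'a::complex_inner set \<Rightarrow> ('a \<Rightarrow> 'a) \<Rightarrow> bool" where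
  "unitary_on G U \<longleftrightarrow> U \<in> bounded_ops G \<and>
     (\<forall>x\<in>G. adj_on G U (U x) = x) \<and> (\<forall>x\<in>G. U (adj_on G U x) = x)"

definition symmetry_on :: "'a::complex_inner set \<Rightarrow> ('a \<Rightarrow> 'a) \<Rightarrow> bool" where
  "symmetry_on G U \<longleftrightarrow> unitary_on G U \<and> adj_on G U = U"

definition reduces_to_symmetry :: "'a::complex_inner set \<Rightarrow> ('a \<Rightarrow> 'a) \<Rightarrow> bool" where
  "reduces_to_symmetry G T \<longleftrightarrow> csubspace G \<and> closed G \<and>
     T ` G \<subseteq> G \<and> adj T ` G \<subseteq> G \<and> symmetry_on G (restrict T G)"

definition null_space :: "('a::complex_inner \<Rightarrow> 'a) \<Rightarrow> 'a set" where
  "null_space A = {x. A x = 0}"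

definition contractive :: "('a::complex_inner \<Rightarrow> 'a) \<Rightarrow> bool" where
  "contractive T \<longleftrightarrow> onorm T \<le> 1"

definition quasi_isometry :: "nat \<Rightarrow> ('a::complex_inner \<Rightarrow> 'a) \<Rightarrow> bool" where
  "quasi_isometry m T \<longleftrightarrow> (\<forall>x \<in> range (T ^^ m). norm (T x) = norm x)"

definition self_adjoint :: "('a::complex_inner \<Rightarrow> 'a) \<Rightarrow> bool" where
  "self_adjoint A \<longleftrightarrow> adj A = A"

text \<open>
  For self-adjoint operators, the only ones to which the order is applied, the quadratic forms
  below are real-valued.
\<close>

definition op_le :: "('a::complex_inner \<Rightarrow> 'a) \<Rightarrow> ('a \<Rightarrow> 'a) \<Rightarrow> bool" where
  "op_le A B \<longleftrightarrow> (\<forall>x. Re (cinner (A x) x) \<le> Re (cinner (B x) x))"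

definition positive_op :: "('a::complex_inner \<Rightarrow> 'a) \<Rightarrow> bool" where
  "positive_op A \<longleftrightarrow> A \<in> bounded_ops UNIV \<and> self_adjoint A \<and> op_le (\<lambda>_. 0) A"

definition op_sqrt :: "('a::complex_inner \<Rightarrow> 'a) \<Rightarrow> 'a \<Rightarrow> 'a" where
  "op_sqrt A = (THE P. positive_op P \<and> P \<circ> P = A)"

definition op_abs :: "('a::complex_inner \<Rightarrow> 'a) \<Rightarrow> 'a \<Rightarrow> 'a" where
  "op_abs T = op_sqrt (adj T \<circ> T)"

definition op_Re :: "('a::complex_inner \<Rightarrow> 'a) \<Rightarrow> 'a \<Rightarrow> 'a" where
  "op_Re T = (\<lambda>x. (1/2) *\<^sub>C (T x + adj T x))"

definition orthogonal_decomposition :: "'a::complex_inner set \<Rightarrow> 'a set \<Rightarrow> bool" where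
  "orthogonal_decomposition G K \<longleftrightarrow>
     csubspace G \<and> closed G \<and> csubspace K \<and> closed K \<and>
     (\<forall>g\<in>G. \<forall>k\<in>K. cinner g k = 0) \<and> (\<forall>x. \<exists>g\<in>G. \<exists>k\<in>K. x = g + k)"

text \<open>
  The operator \<open>A \<oplus> B\<close>, for operators \<open>A\<close> on \<open>G\<close> and \<open>B\<close> on \<open>K\<close>; meaningful when \<open>G\<close> and \<open>K\<close> form
  an orthogonal decomposition of the whole space.
\<close>

definition op_direct_sum ::
  "'a::complex_inner set \<Rightarrow> 'a set \<Rightarrow> ('a \<Rightarrow> 'a) \<Rightarrow> ('a \<Rightarrow> 'a) \<Rightarrow> 'a \<Rightarrow> 'a" where
  "op_direct_sum G K A B = (\<lambda>x. THE y. \<exists>g\<in>G. \<exists>k\<in>K. x = g + k \<and> y = A g + B k)"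

end

theory Submission
  imports Defs
begin

text \<open>
  If \<open>T\<^sup>* T x = x\<close>, then \<open>|T| x = x\<close>, so \<open>\<parallel>x\<parallel>\<^sup>2 \<le> \<langle>|Re T| x, x\<rangle>\<close>; as \<open>Re T\<close> is a contraction, this
  forces \<open>|Re T| x = x\<close> and hence \<open>(Re T)\<^sup>2 x = x\<close>. Equality in the triangle inequality for
  \<open>T x + T\<^sup>* x\<close> gives \<open>T x = T\<^sup>* x\<close>, and then \<open>T\<^sup>2 x = x\<close>. Thus \<open>T\<close> is a symmetry on
  \<open>N(I - T\<^sup>* T)\<close>, which lies in the range of every power of \<open>T\<close>; conversely the
  quasi-isometry condition puts the range of \<open>T\<^sup>m\<close> into \<open>N(I - T\<^sup>* T)\<close>. Finally,
  \<open>T\<^sup>2\<^sup>m x\<close> is the orthogonal projection of \<open>x\<close> onto this subspace, which gives the decomposition.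
\<close>

instance chilbert_space \<subseteq> banach ..

section \<open>Inner product\<close>

lemma scaleC_zero_right [simp]: "c *\<^sub>C (0::'a::complex_inner) = 0"
  using scaleC_add_right[of c 0 0] by simp

lemma scaleC_minus_one [simp]: "(- 1) *\<^sub>C x = - (x::'a::complex_inner)"
  using scaleC_of_real[of "-1" x] by simp

lemma scaleC_scaleR: "c *\<^sub>C (r *\<^sub>R x) = r *\<^sub>R (c *\<^sub>C (x::'a::complex_inner))"
  unfolding scaleC_of_real[symmetric] scaleC_scaleC by (simp add: mult.commute)

lemma cinner_add_right: "cinner x (y + z) = cinner x y + cinner x (z::'a::complex_inner)"
  by (subst (1 2 3) cinner_commute) (simp add: cinner_add_left)

lemma cinner_scaleC_right: "cinner x (c *\<^sub>C y) = cnj c * cinner x (y::'a::complex_inner)"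
  by (subst (1 2) cinner_commute) (simp add: cinner_scaleC_left)

lemma cinner_scaleR_left: "cinner (r *\<^sub>R x) y = r *\<^sub>R cinner x (y::'a::complex_inner)"
  using cinner_scaleC_left[of "of_real r" x y] by (simp add: scaleC_of_real scaleR_conv_of_real)

lemma cinner_scaleR_right: "cinner x (r *\<^sub>R y) = r *\<^sub>R cinner x (y::'a::complex_inner)"
  using cinner_scaleC_right[of x "of_real r" y] by (simp add: scaleC_of_real scaleR_conv_of_real)

lemma Re_cinner_commute: "Re (cinner x y) = Re (cinner y (x::'a::complex_inner))"
  by (subst cinner_commute) simp

lemma norm_add_power2:
  "(norm (x + y))\<^sup>2 = (norm x)\<^sup>2 + (norm y)\<^sup>2 + 2 * Re (cinner x (y::'a::complex_inner))"
proof -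
  have "(norm (x + y))\<^sup>2 = Re (cinner (x + y) (x + y))"
    by (simp add: cinner_self)
  also have "\<dots> = Re (cinner x x) + Re (cinner y y) + Re (cinner x y) + Re (cinner y x)"
    by (simp add: cinner_add_left cinner_add_right del: cinner_self)
  finally show ?thesis
    by (simp add: cinner_self Re_cinner_commute[of y x])
qed

text \<open>Real Cauchy-Schwarz: expanding the squared norm of
  \<open>norm y *\<^sub>R x - norm x *\<^sub>R y\<close> leaves the positive factor
  \<open>2 * p\<close>, which can be cancelled.\<close>

lemma Re_cinner_le: "Re (cinner x y) \<le> norm x * norm (y::'a::complex_inner)"
proof (cases "x = 0 \<or> y = 0")
  case True
  then show ?thesis
    using cinner_scaleR_left[of 0 x y] cinner_scaleR_right[of x 0 y] by auto
next
  case False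
  define p where "p = norm x * norm y"
  have p: "0 < p" using False by (simp add: p_def)
  have "0 \<le> (norm (norm y *\<^sub>R x + (- norm x) *\<^sub>R y))\<^sup>2" by simp
  also have "\<dots> = 2 * p * (p - Re (cinner x y))"
    unfolding norm_add_power2 cinner_scaleR_left cinner_scaleR_right p_def
    by (simp add: power2_eq_square algebra_simps)
  finally show ?thesis
    using p by (simp add: zero_le_mult_iff p_def)
qed

lemma norm_scaleC: "norm (c *\<^sub>C x) = cmod c * norm (x::'a::complex_inner)"
proof -
  have "complex_of_real ((norm (c *\<^sub>C x))\<^sup>2) = c * cnj c * cinner x x"
    by (simp only: cinner_self[symmetric] cinner_scaleC_left cinner_scaleC_right mult_ac)
  also have "\<dots> = complex_of_real ((cmod c * norm x)\<^sup>2)"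
    by (simp add: complex_norm_square[symmetric] cinner_self power_mult_distrib)
  finally have "(norm (c *\<^sub>C x))\<^sup>2 = (cmod c * norm x)\<^sup>2"
    by (simp only: of_real_eq_iff)
  then show ?thesis by simp
qed

lemma bounded_linear_scaleC: "bounded_linear (\<lambda>x::'a::complex_inner. c *\<^sub>C x)"
  by (rule bounded_linear_intro[where K = "cmod c"])
    (simp_all add: scaleC_add_right scaleC_scaleR norm_scaleC)

text \<open>Rotating \<open>x\<close> by a unimodular scalar makes the inner product real and
  nonnegative without changing \<open>norm x\<close>, so the real estimate applies.\<close>

lemma norm_cinner_le: "norm (cinner x y) \<le> norm x * norm (y::'a::complex_inner)"
proof (cases "cinner x y = 0")
  case False
  define c where "c = cnj (sgn (cinner x y))"
  have "c * cinner x y = complex_of_real (cmod (cinner x y))"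
    using False unfolding c_def sgn_eq
    by (simp add: field_simps complex_norm_square[symmetric] power2_eq_square)
  then have "cmod (cinner x y) = Re (cinner (c *\<^sub>C x) y)"
    by (simp add: cinner_scaleC_left)
  also have "\<dots> \<le> norm (c *\<^sub>C x) * norm y"
    by (rule Re_cinner_le)
  also have "norm (c *\<^sub>C x) = norm x"
    using False by (simp add: norm_scaleC c_def norm_sgn)
  finally show ?thesis .
qed simp

interpretation cinner: bounded_bilinear "cinner :: 'a::complex_inner \<Rightarrow> 'a \<Rightarrow> complex"
  by standard
    (auto simp: cinner_add_left cinner_add_right cinner_scaleR_left cinner_scaleR_right
      intro!: exI[of _ 1] norm_cinner_le)

lemma cinner_ext_right:
  assumes "\<And>x. cinner x y = cinner x (z::'a::complex_inner)"
  shows "y = z"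
proof -
  have "cinner (y - z) (y - z) = 0"
    by (simp add: cinner.diff_right assms)
  then show ?thesis by (simp add: cinner_self)
qed

section \<open>The adjoint\<close>

text \<open>First-order condition at a minimum \<open>t = 0\<close>; it serves both for minimising
  \<open>J\<close> and for vectors at which a positive form vanishes.\<close>

lemma linear_coeff_zero:
  fixes a b :: real
  assumes "\<And>t. 0 \<le> t\<^sup>2 * a + 2 * t * b"
  shows "b = 0"
proof (rule ccontr)
  assume "b \<noteq> 0"
  \<comment> \<open>This choice gives \<open>a < 2 * c\<close> whatever the sign of
    \<open>a\<close>; testing at \<open>t = - b / c\<close> then yields a negative value.\<close>
  define c where "c = \<bar>a\<bar> + 1"
  have "c > 0" "a < c" unfolding c_def by linarith+
  then have c: "c > 0" "a < 2 * c" by simp_all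
  have "0 \<le> c\<^sup>2 * ((- b / c)\<^sup>2 * a + 2 * (- b / c) * b)"
    by (intro mult_nonneg_nonneg assms) simp
  also have "\<dots> = b\<^sup>2 * (a - 2 * c)"
    using c by (simp add: field_simps power2_eq_square)
  also have "\<dots> < 0"
    using c \<open>b \<noteq> 0\<close> by (intro mult_pos_neg) auto
  finally show False by simp
qed

text \<open>
  The representing vector minimises \<open>J\<close>; minimising sequences are Cauchy by the parallelogram law.
\<close>

lemma real_riesz:
  fixes g :: "'a::chilbert_space \<Rightarrow> real"
  assumes "bounded_linear g"
  obtains z where "\<And>x. g x = Re (cinner x z)"
proof -
  interpret g: bounded_linear g by fact
  define J where "J x = (norm x)\<^sup>2 - 2 * g x" for x
  obtain K where K: "\<And>x. norm (g x) \<le> norm x * K"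
    using g.bounded by blast
  have lower: "- K\<^sup>2 \<le> J x" for x
  proof -
    have "0 \<le> (norm x - K)\<^sup>2" by simp
    also have "\<dots> = (norm x)\<^sup>2 - 2 * (norm x * K) + K\<^sup>2"
      by (simp add: power2_eq_square algebra_simps)
    finally show ?thesis
      using K[of x] unfolding J_def by simp
  qed
  define d where "d = (INF x. J x)"
  have bdd: "bdd_below (range J)"
    using lower by (intro bdd_belowI2)
  have d_le: "d \<le> J x" for x
    unfolding d_def by (rule cINF_lower[OF bdd]) simp
  have "\<exists>x. J x < d + 1 / Suc n" for n
  proof -
    have "(INF x. J x) < d + 1 / Suc n"
      by (simp add: d_def)
    then show ?thesis
      using cINF_less_iff[OF _ bdd] by auto
  qed
  then obtain X where X: "\<And>n. J (X n) < d + 1 / Suc n"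
    by metis
  have par: "(norm (x - y))\<^sup>2 \<le> 2 * (J x - d) + 2 * (J y - d)" for x y
  proof -
    have "J ((1/2) *\<^sub>R (x + y)) = (norm (x + y))\<^sup>2 / 4 - (g x + g y)"
      unfolding J_def norm_scaleR g.scaleR g.add power_mult_distrib
        by (simp add: power_divide add_divide_distrib)
    moreover have "(norm (x + y))\<^sup>2 + (norm (x - y))\<^sup>2 = 2 * (norm x)\<^sup>2 + 2 * (norm y)\<^sup>2"
      using norm_add_power2[of x y] norm_add_power2[of x "- y"]
      by (simp add: cinner.minus_right)
    ultimately show ?thesis
      using d_le[of "(1/2) *\<^sub>R (x + y)"] unfolding J_def by simp
  qed
  have "Cauchy X"
  proof (rule metric_CauchyI)
    fix e :: real assume e: "0 < e"
    then obtain N where N: "4 / Suc N < e\<^sup>2"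
      using reals_Archimedean[of "e\<^sup>2 / 4"] by (auto simp: field_simps)
    have close: "J (X i) - d \<le> 1 / Suc N" if "N \<le> i" for i
    proof -
      have "1 / real (Suc i) \<le> 1 / real (Suc N)"
        using that by (intro divide_left_mono) auto
      then show ?thesis using X[of i] by simp
    qed
    have "dist (X i) (X j) < e" if "N \<le> i" "N \<le> j" for i j
    proof -
      have "(norm (X i - X j))\<^sup>2 \<le> 2 * (1 / Suc N) + 2 * (1 / Suc N)"
        by (rule order_trans[OF par]) (intro add_mono mult_left_mono close that; simp)
      then have "(norm (X i - X j))\<^sup>2 < e\<^sup>2"
        using N by simp
      then show ?thesis
        using e by (simp add: dist_norm power2_less_imp_less)
    qed
    then show "\<exists>N. \<forall>i\<ge>N. \<forall>j\<ge>N. dist (X i) (X j) < e" by blast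
  qed
  then obtain z where z: "X \<longlonglongrightarrow> z"
    using Cauchy_convergent_iff convergent_def by blast
  have "(\<lambda>n. J (X n)) \<longlonglongrightarrow> J z"
    unfolding J_def by (intro tendsto_intros g.tendsto z)
  moreover have "(\<lambda>n. d + 1 / real (Suc n)) \<longlonglongrightarrow> d + 0"
    using LIMSEQ_inverse_real_of_nat by (intro tendsto_intros) (simp add: inverse_eq_divide)
  ultimately have "J z \<le> d"
    using X by (intro LIMSEQ_le[where X = "\<lambda>n. J (X n)" and Y = "\<lambda>n. d + 1 / real (Suc n)"])
      (auto intro: less_imp_le)
  have "g w = Re (cinner w z)" for w
  proof -
    \<comment> \<open>The right-hand side is \<open>J (z + t *\<^sub>R w) - J z\<close>, nonnegative
      since \<open>z\<close> is a minimiser; hence its linear coefficient vanishes.\<close>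
    have "0 \<le> t\<^sup>2 * (norm w)\<^sup>2 + 2 * t * (Re (cinner w z) - g w)" for t
    proof -
      have "J z \<le> J (z + t *\<^sub>R w)"
        using \<open>J z \<le> d\<close> d_le order_trans by blast
      then show ?thesis
        unfolding J_def norm_add_power2
        by (simp add: g.add g.scaleR cinner_scaleR_right Re_cinner_commute[of z w]
            power_mult_distrib algebra_simps)
    qed
    then show ?thesis using linear_coeff_zero by fastforce
  qed
  then show thesis by (rule that)
qed

text \<open>A complex-linear functional is determined by its real part: the imaginary part at
  \<open>x\<close> is read off from the real part at \<open>\<i> *\<^sub>C x\<close>.\<close>

lemma riesz:
  fixes f :: "'a::chilbert_space \<Rightarrow> complex"
  assumes "bounded_linear f" and scale: "\<And>c x. f (c *\<^sub>C x) = c * f x"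
  obtains z where "\<And>x. f x = cinner x z"
proof -
  obtain z where z: "\<And>x. Re (f x) = Re (cinner x z)"
    using real_riesz bounded_linear_compose[OF bounded_linear_Re assms(1)] by blast
  have "f x = cinner x z" for x
    using z[of x] z[of "\<i> *\<^sub>C x"] by (simp add: scale cinner_scaleC_left complex_eq_iff)
  then show thesis by (rule that)
qed

section \<open>Uniqueness and existence of adjoints\<close>

lemma csubspace_UNIV [simp]: "csubspace UNIV"
  by (simp add: csubspace_def)

text \<open>Resolves the definite description in \<open>adj_on\<close>. The difference of two
  candidates at \<open>y\<close> stays in \<open>G\<close>, so it is a legitimate test vector;
  outside \<open>G\<close> extensionality fixes the values.\<close>

lemma adj_on_eqI:
  assumes G: "csubspace G" and B: "B \<in> bounded_ops G"
    and AB: "\<And>x y. x \<in> G \<Longrightarrow> y \<in> G \<Longrightarrow> cinner (A x) y = cinner x (B y)"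
  shows "adj_on G A = B"
  unfolding adj_on_def
proof (rule the_equality)
  fix C assume C: "C \<in> bounded_ops G \<and> (\<forall>x\<in>G. \<forall>y\<in>G. cinner (A x) y = cinner x (C y))"
  have ext: "C \<in> extensional G" "B \<in> extensional G"
    using B C by (auto simp: bounded_ops_def PiE_def)
  show "C = B"
  proof (rule extensionalityI[OF ext])
    fix y assume y: "y \<in> G"
    then have "C y \<in> G" "B y \<in> G"
      using B C by (auto simp: bounded_ops_def)
    then have "C y + (- 1) *\<^sub>C B y \<in> G"
      using G unfolding csubspace_def by blast
    then have "cinner (C y - B y) (C y) = cinner (C y - B y) (B y)"
      using C AB y by simp
    then have "cinner (C y - B y) (C y - B y) = 0"
      by (simp add: cinner.diff_right)
    then show "C y = B y" by (simp add: cinner_self)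
  qed
qed (use B AB in auto)

text \<open>Riesz gives \<open>B y\<close> for each \<open>y\<close> separately. The bound comes
  from testing at \<open>x = B y\<close> and cancelling one factor \<open>norm (B y)\<close>, whence
  the case split.\<close>

lemma adj_exists:
  fixes A :: "'a::chilbert_space \<Rightarrow> 'a"
  assumes "A \<in> bounded_ops UNIV"
  obtains B where "B \<in> bounded_ops UNIV" "\<And>x y. cinner (A x) y = cinner x (B y)"
proof -
  interpret A: bounded_linear A
    using assms by (simp add: bounded_ops_UNIV_iff)
  have AC: "A (c *\<^sub>C x) = c *\<^sub>C A x" for c x
    using assms by (simp add: bounded_ops_UNIV_iff)
  have "\<exists>z. \<forall>x. cinner (A x) y = cinner x z" for y
    by (rule riesz[of "\<lambda>x. cinner (A x) y"])
      (auto simp: AC cinner_scaleC_left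
        intro: bounded_linear_compose[OF cinner.bounded_linear_left A.bounded_linear_axioms])
  then obtain B where B: "\<And>x y. cinner (A x) y = cinner x (B y)"
    by metis
  obtain K where K: "\<And>x. norm (A x) \<le> norm x * K"
    using A.bounded by blast
  have "norm (B y) \<le> norm y * K" for y
  proof (cases "B y = 0")
    case True
    then show ?thesis
      using order_trans[OF norm_ge_zero K[of y]] by simp
  next
    case False
    have "(norm (B y))\<^sup>2 = Re (cinner (A (B y)) y)"
      by (simp add: B cinner_self)
    also have "\<dots> \<le> norm (A (B y)) * norm y"
      by (rule Re_cinner_le)
    also have "\<dots> \<le> norm (B y) * K * norm y"
      by (intro mult_right_mono K) simp
    finally show ?thesis
      using False by (simp add: power2_eq_square mult_ac)
  qed
  moreover have "B (x + y) = B x + B y" for x y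
    by (rule cinner_ext_right) (simp add: B[symmetric] cinner_add_right)
  moreover have BC: "B (c *\<^sub>C x) = c *\<^sub>C B x" for c x
    by (rule cinner_ext_right) (simp add: B[symmetric] cinner_scaleC_right)
  moreover have "B (r *\<^sub>R x) = r *\<^sub>R B x" for r x
    using BC[of "complex_of_real r" x] by (simp add: scaleC_of_real)
  ultimately have "B \<in> bounded_ops UNIV"
    unfolding bounded_ops_UNIV_iff by (auto intro: bounded_linear_intro[where K = K])
  then show thesis using B by (rule that)
qed

lemma
  fixes A :: "'a::chilbert_space \<Rightarrow> 'a"
  assumes "A \<in> bounded_ops UNIV"
  shows adj_bounded_ops: "adj A \<in> bounded_ops UNIV"
    and cinner_adj: "cinner (A x) y = cinner x (adj A y)"
proof -
  obtain B where B: "B \<in> bounded_ops UNIV" "\<And>x y. cinner (A x) y = cinner x (B y)"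
    using adj_exists[OF assms] by metis
  then have "adj A = B"
    by (intro adj_on_eqI) auto
  with B show "adj A \<in> bounded_ops UNIV" "cinner (A x) y = cinner x (adj A y)"
    by auto
qed

lemma cinner_adj':
  fixes A :: "'a::chilbert_space \<Rightarrow> 'a"
  assumes "A \<in> bounded_ops UNIV"
  shows "cinner (adj A x) y = cinner x (A y)"
  by (metis assms cinner_adj cinner_commute)

lemma norm_adj_le:
  fixes A :: "'a::chilbert_space \<Rightarrow> 'a"
  assumes A: "A \<in> bounded_ops UNIV" and le: "\<And>x. norm (A x) \<le> norm x"
  shows "norm (adj A y) \<le> norm y"
proof (cases "adj A y = 0")
  case False
  have "(norm (adj A y))\<^sup>2 = Re (cinner (A (adj A y)) y)"
    by (simp add: cinner_adj[OF A] cinner_self)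
  also have "\<dots> \<le> norm (A (adj A y)) * norm y"
    by (rule Re_cinner_le)
  also have "\<dots> \<le> norm (adj A y) * norm y"
    by (intro mult_right_mono le) simp
  finally show ?thesis
    using False by (simp add: power2_eq_square)
qed simp

section \<open>Square roots\<close>

text \<open>A limit \<open>Y\<close> satisfies \<open>2Y = B + Y\<^sup>2\<close>, that is, \<open>(I - Y)\<^sup>2 = I - B\<close>.\<close>

primrec sqrt_iter :: "'a::real_normed_vector \<Rightarrow>\<^sub>L 'a \<Rightarrow> nat \<Rightarrow> 'a \<Rightarrow>\<^sub>L 'a" where
  "sqrt_iter B 0 = 0"
| "sqrt_iter B (Suc n) = (1/2) *\<^sub>R (B + (sqrt_iter B n o\<^sub>L sqrt_iter B n))"

text \<open>The scalar iteration with \<open>b = 1\<close>, which dominates the operator iteration in norm.\<close>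

primrec scalar_iter :: "nat \<Rightarrow> real" where
  "scalar_iter 0 = 0"
| "scalar_iter (Suc n) = (1 + (scalar_iter n)\<^sup>2) / 2"

lemma scalar_iter_bounds: "0 \<le> scalar_iter n \<and> scalar_iter n \<le> 1"
proof (induction n)
  case (Suc n)
  then have "(scalar_iter n)\<^sup>2 \<le> 1" by (simp add: power_le_one)
  then show ?case by simp
qed simp

lemma scalar_iter_mono: "scalar_iter n \<le> scalar_iter (Suc n)"
proof -
  have "0 \<le> (1 - scalar_iter n)\<^sup>2" by simp
  then show ?thesis by (simp add: power2_eq_square algebra_simps)
qed

lemma norm_sqrt_iter_le:
  assumes "norm B \<le> 1"
  shows "norm (sqrt_iter B n) \<le> scalar_iter n"
proof (induction n)
  case (Suc n)
  have "norm (sqrt_iter B n o\<^sub>L sqrt_iter B n) \<le> norm (sqrt_iter B n) * norm (sqrt_iter B n)"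
    by (rule norm_blinfun_compose)
  also have "\<dots> \<le> (scalar_iter n)\<^sup>2"
    unfolding power2_eq_square using Suc scalar_iter_bounds by (intro mult_mono) auto
  finally show ?case
    using norm_triangle_ineq[of B "sqrt_iter B n o\<^sub>L sqrt_iter B n"] assms by simp
qed simp

text \<open>The splitting of \<open>Z\<close> squared minus \<open>Y\<close> squared as
  \<open>Z (Z - Y) + (Z - Y) Y\<close> needs no commutation, and the scalar increments satisfy the
  same identity exactly.\<close>

lemma norm_sqrt_iter_diff_le:
  assumes "norm B \<le> 1"
  shows "norm (sqrt_iter B (Suc n) - sqrt_iter B n) \<le> scalar_iter (Suc n) - scalar_iter n"
proof (induction n)
  case 0
  then show ?case using assms by simp
next
  case (Suc n)
  define Y Z y z where "Y = sqrt_iter B n" and "Z = sqrt_iter B (Suc n)"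
    and "y = scalar_iter n" and "z = scalar_iter (Suc n)"
  have YZ: "norm (Z - Y) \<le> z - y" "norm Y \<le> y" "norm Z \<le> z" "0 \<le> y" "0 \<le> z" "y \<le> z"
    using Suc scalar_iter_mono norm_sqrt_iter_le[OF assms] scalar_iter_bounds
    unfolding Y_def Z_def y_def z_def by blast+
  have "sqrt_iter B (Suc (Suc n)) - sqrt_iter B (Suc n)
      = (1/2) *\<^sub>R (B + (Z o\<^sub>L Z)) - (1/2) *\<^sub>R (B + (Y o\<^sub>L Y))"
    by (simp add: Y_def Z_def)
  also have "\<dots> = (1/2) *\<^sub>R ((Z o\<^sub>L (Z - Y)) + ((Z - Y) o\<^sub>L Y))"
    by (rule blinfun_eqI) (simp add: blinfun.bilinear_simps scaleR_diff_right[symmetric])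
  also have "norm \<dots> \<le> (norm (Z o\<^sub>L (Z - Y)) + norm ((Z - Y) o\<^sub>L Y)) / 2"
    using norm_triangle_ineq[of "Z o\<^sub>L (Z - Y)" "(Z - Y) o\<^sub>L Y"] by simp
  also have "\<dots> \<le> (norm Z * norm (Z - Y) + norm (Z - Y) * norm Y) / 2"
    by (intro divide_right_mono add_mono norm_blinfun_compose) simp
  also have "\<dots> \<le> (z * (z - y) + (z - y) * y) / 2"
    using YZ
    by (intro divide_right_mono add_mono mult_mono) auto
  also have "\<dots> = (1 + z\<^sup>2) / 2 - (1 + y\<^sup>2) / 2"
    by (simp add: power2_eq_square field_simps)
  also have "\<dots> = scalar_iter (Suc (Suc n)) - scalar_iter (Suc n)"
    by (simp add: y_def z_def)
  finally show ?case .
qed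

text \<open>The scalar sequence is monotone and bounded, so its increments are summable; by
  domination the operator increments are absolutely summable in operator norm.\<close>

lemma sqrt_iter_converges:
  fixes B :: "'a::banach \<Rightarrow>\<^sub>L 'a"
  assumes "norm B \<le> 1"
  obtains Y where "sqrt_iter B \<longlonglongrightarrow> Y" "norm Y \<le> 1" "Y = (1/2) *\<^sub>R (B + (Y o\<^sub>L Y))"
proof -
  have "Bseq scalar_iter"
    using scalar_iter_bounds by (intro BseqI'[of _ 1]) simp
  then have "convergent scalar_iter"
    using scalar_iter_mono by (intro Bseq_monoseq_convergent) (auto simp: monoseq_Suc)
  then have "summable (\<lambda>n. scalar_iter (Suc n) - scalar_iter n)"
    using telescope_summable convergent_def by blast
  then have "summable (\<lambda>n. sqrt_iter B (Suc n) - sqrt_iter B n)"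
    by (rule summable_comparison_test') (rule norm_sqrt_iter_diff_le[OF assms])
  then have "convergent (\<lambda>n. \<Sum>k<n. sqrt_iter B (Suc k) - sqrt_iter B k)"
    by (simp add: summable_iff_convergent)
  then have "convergent (sqrt_iter B)"
    unfolding sum_lessThan_telescope by simp
  then obtain Y where Y: "sqrt_iter B \<longlonglongrightarrow> Y"
    by (auto simp: convergent_def)
  have "norm (sqrt_iter B n) \<le> 1" for n
    using norm_sqrt_iter_le[OF assms, of n] scalar_iter_bounds[of n] by simp
  then have "norm Y \<le> 1"
    using LIMSEQ_le_const2[OF tendsto_norm[OF Y]] by blast
  moreover have "(\<lambda>n. sqrt_iter B (Suc n)) \<longlonglongrightarrow> (1/2) *\<^sub>R (B + (Y o\<^sub>L Y))"
    unfolding sqrt_iter.simps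
    by (intro tendsto_intros bounded_bilinear.tendsto[OF bounded_bilinear_blinfun_compose] Y)
  then have "Y = (1/2) *\<^sub>R (B + (Y o\<^sub>L Y))"
    using LIMSEQ_unique LIMSEQ_Suc[OF Y] by blast
  ultimately show thesis using Y that by blast
qed

text \<open>Only real linearity of \<open>C\<close> is asked for, so multiplication by a complex
  scalar is an admissible choice.\<close>

lemma sqrt_iter_commute:
  assumes "bounded_linear C" and "\<And>x. blinfun_apply B (C x) = C (B x)"
  shows "sqrt_iter B n (C x) = C (sqrt_iter B n x)"
proof -
  interpret C: bounded_linear C by fact
  show ?thesis
    by (induction n arbitrary: x)
      (simp_all add: blinfun.bilinear_simps C.zero C.add C.scaleR assms(2))
qed

lemma sqrt_iter_symmetric:
  fixes B :: "'a::complex_inner \<Rightarrow>\<^sub>L 'a"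
  assumes "\<And>x y. cinner (B x) y = cinner x (B y)"
  shows "cinner (sqrt_iter B n x) y = cinner x (sqrt_iter B n y)"
  by (induction n arbitrary: x y)
    (simp_all add: blinfun.bilinear_simps cinner.zero_left cinner.zero_right cinner_add_left
      cinner_add_right cinner_scaleR_left cinner_scaleR_right assms)

section \<open>Positive operators and uniqueness of their square roots\<close>

lemma positive_op_symmetric:
  fixes P :: "'a::chilbert_space \<Rightarrow> 'a"
  assumes "positive_op P"
  shows "cinner (P x) y = cinner x (P y)"
  using assms cinner_adj[of P x y] by (simp add: positive_op_def self_adjoint_def)

text \<open>Along \<open>y + t *\<^sub>R P y\<close> the form is a nonnegative quadratic in
  \<open>t\<close> without constant term, and its linear coefficient is twice the square of
  \<open>norm (P y)\<close>.\<close>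

lemma positive_op_form_zero:
  fixes P :: "'a::chilbert_space \<Rightarrow> 'a"
  assumes P: "positive_op P" and zero: "Re (cinner (P y) y) = 0"
  shows "P y = 0"
proof -
  interpret P: bounded_linear P
    using P by (simp add: positive_op_def bounded_ops_UNIV_iff)
  have "0 \<le> t\<^sup>2 * Re (cinner (P (P y)) (P y)) + 2 * t * (norm (P y))\<^sup>2" for t
  proof -
    have "0 \<le> Re (cinner (P (y + t *\<^sub>R P y)) (y + t *\<^sub>R P y))"
      using P by (simp add: positive_op_def op_le_def cinner.zero_left)
    also have "\<dots> = Re (cinner (P y) y) + t * Re (cinner (P y) (P y))
        + t * Re (cinner (P (P y)) y) + t\<^sup>2 * Re (cinner (P (P y)) (P y))"
      by (simp add: P.add P.scaleR cinner_add_left cinner_add_right cinner_scaleR_left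
          cinner_scaleR_right power2_eq_square algebra_simps)
    also have "cinner (P (P y)) y = cinner (P y) (P y)"
      by (rule positive_op_symmetric[OF P])
    finally show ?thesis by (simp add: zero cinner_self)
  qed
  from linear_coeff_zero[OF this] show ?thesis by simp
qed

text \<open>Commutation gives \<open>(P + Q) (P - Q) = 0\<close>. At \<open>y = P x - Q x\<close>
  the two nonnegative forms add up to zero, so \<open>P y = Q y = 0\<close>, and symmetry turns this
  into \<open>cinner y y = 0\<close>.\<close>

lemma positive_sqrt_unique:
  fixes P Q :: "'a::chilbert_space \<Rightarrow> 'a"
  assumes P: "positive_op P" and Q: "positive_op Q" and sq: "\<And>x. P (P x) = Q (Q x)"
    and comm: "\<And>x. P (Q x) = Q (P x)"
  shows "P = Q"
proof
  fix x
  interpret P: bounded_linear P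
    using P by (simp add: positive_op_def bounded_ops_UNIV_iff)
  interpret Q: bounded_linear Q
    using Q by (simp add: positive_op_def bounded_ops_UNIV_iff)
  define y where "y = P x - Q x"
  have "P y + Q y = 0"
    by (simp add: y_def P.diff Q.diff sq comm)
  then have "Re (cinner (P y) y) + Re (cinner (Q y) y) = 0"
    by (metis cinner.add_left cinner.zero_left plus_complex.sel(1) zero_complex.sel(1))
  moreover have "0 \<le> Re (cinner (P y) y)" "0 \<le> Re (cinner (Q y) y)"
    using P Q by (simp_all add: positive_op_def op_le_def cinner.zero_left)
  ultimately have "Re (cinner (P y) y) = 0" "Re (cinner (Q y) y) = 0"
    by linarith+
  then have "P y = 0" "Q y = 0"
    using positive_op_form_zero P Q by blast+
  moreover have "cinner y y = cinner (P x) y - cinner (Q x) y"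
    by (simp add: y_def cinner.diff_left)
  ultimately have "cinner y y = 0"
    by (simp add: positive_op_symmetric[OF P] positive_op_symmetric[OF Q] cinner.zero_right)
  then show "P x = Q x"
    by (simp add: cinner_self y_def)
qed

text \<open>Resolves the definite description behind \<open>op_abs\<close>. Contractivity bounds
  \<open>I - adj C C\<close> by 1 in norm, so the iteration converges and \<open>I - Y\<close> is
  the root. Contractions suffice because \<open>T\<close> and its real part are both
  contractive.\<close>

lemma positive_op_op_abs_contraction:
  fixes C :: "'a::chilbert_space \<Rightarrow> 'a"
  assumes C: "C \<in> bounded_ops UNIV" and le: "\<And>x. norm (C x) \<le> norm x"
  shows "positive_op (op_abs C) \<and> op_abs C \<circ> op_abs C = adj C \<circ> C"
proof -
  define A where "A = adj C \<circ> C"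
  have lin: "bounded_linear C" "bounded_linear (adj C)"
    and CC: "\<And>c x. C (c *\<^sub>C x) = c *\<^sub>C C x" "\<And>c x. adj C (c *\<^sub>C x) = c *\<^sub>C adj C x"
    using C adj_bounded_ops[OF C] by (simp_all add: bounded_ops_UNIV_iff)
  have A_lin: "bounded_linear A"
    unfolding A_def comp_def by (rule bounded_linear_compose[OF lin(2) lin(1)])
  have AC: "A (c *\<^sub>C x) = c *\<^sub>C A x" for c x
    by (simp add: A_def CC)
  have A_sym: "cinner (A x) y = cinner x (A y)" for x y
    by (simp add: A_def cinner_adj[OF C] cinner_adj'[OF C])
  have "bounded_linear (\<lambda>x. x - A x)"
    by (intro bounded_linear_sub bounded_linear_ident A_lin)
  then obtain B where B: "\<And>x. blinfun_apply B x = x - A x"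
    by (metis bounded_linear_Blinfun_apply)
  have "norm B \<le> 1"
  proof (rule norm_blinfun_bound)
    fix x
    \<comment> \<open>Bounds the quadratic term in the expansion of \<open>norm (x - A x)\<close>
      squared by the cross term \<open>2 * Re (cinner x (A x))\<close>.\<close>
    have "(norm (A x))\<^sup>2 \<le> (norm (C x))\<^sup>2"
      unfolding A_def comp_def by (intro power_mono norm_adj_le C le) simp
    also have "\<dots> = Re (cinner x (A x))"
      by (simp add: A_def cinner_adj[OF C, symmetric] cinner_self)
    also have "\<dots> \<le> 2 * \<dots>"
      by (simp add: A_def cinner_adj[OF C, symmetric] cinner_self)
    finally have "(norm (x + - A x))\<^sup>2 \<le> (norm x)\<^sup>2"
      unfolding norm_add_power2 by (simp add: cinner.minus_right)
    then show "norm (B x) \<le> 1 * norm x"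
      by (simp add: B)
  qed simp
  then obtain Y where Y: "sqrt_iter B \<longlonglongrightarrow> Y" "norm Y \<le> 1" "Y = (1/2) *\<^sub>R (B + (Y o\<^sub>L Y))"
    by (rule sqrt_iter_converges)
  have Y_lim: "(\<lambda>n. sqrt_iter B n x) \<longlonglongrightarrow> Y x" for x
    by (intro tendsto_intros Y)
  \<comment> \<open>Needed twice: with \<open>D\<close> a complex scalar, for complex linearity of
    \<open>Q\<close>, and with \<open>D\<close> a competing root \<open>P\<close>, for
    uniqueness.\<close>
  have Y_comm: "Y (D x) = D (Y x)" if D: "bounded_linear D" "\<And>x. A (D x) = D (A x)" for D x
  proof -
    interpret D: bounded_linear D by fact
    have "B (D x) = D (B x)" for x
      by (simp add: B D.diff D(2))
    then have "sqrt_iter B n (D x) = D (sqrt_iter B n x)" for n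
      by (rule sqrt_iter_commute[OF D(1)])
    then have "(\<lambda>n. sqrt_iter B n (D x)) \<longlonglongrightarrow> D (Y x)"
      using D.tendsto[OF Y_lim] by simp
    then show ?thesis
      using Y_lim LIMSEQ_unique by blast
  qed
  have Y_sym: "cinner (Y x) y = cinner x (Y y)" for x y
  proof -
    have "cinner (B x) y = cinner x (B y)" for x y
      by (simp add: B cinner.diff_left cinner.diff_right A_sym)
    then have "cinner (sqrt_iter B n x) y = cinner x (sqrt_iter B n y)" for n
      by (rule sqrt_iter_symmetric)
    moreover have "(\<lambda>n. cinner (sqrt_iter B n x) y) \<longlonglongrightarrow> cinner (Y x) y"
      "(\<lambda>n. cinner x (sqrt_iter B n y)) \<longlonglongrightarrow> cinner x (Y y)"
      by (intro cinner.tendsto Y_lim tendsto_const)+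
    ultimately show ?thesis
      using LIMSEQ_unique by simp
  qed
  define Q where "Q = (\<lambda>x. x - Y x)"
  have Q_ops: "Q \<in> bounded_ops UNIV"
    unfolding bounded_ops_UNIV_iff
  proof (intro conjI allI)
    show "bounded_linear Q"
      unfolding Q_def by (intro bounded_linear_sub bounded_linear_ident blinfun.bounded_linear_right)
    show "Q (c *\<^sub>C x) = c *\<^sub>C Q x" for c x
      using Y_comm[OF bounded_linear_scaleC AC, of c x]
      by (simp add: Q_def bounded_linear.linear[OF bounded_linear_scaleC, THEN linear_diff])
  qed
  have Q_pos: "0 \<le> Re (cinner (Q x) x)" for x
  proof -
    have "Re (cinner (Y x) x) \<le> norm (Y x) * norm x"
      by (rule Re_cinner_le)
    also have "norm (Y x) \<le> norm x"
      using norm_blinfun[of Y x] mult_right_mono[OF Y(2) norm_ge_zero[of x]] by simp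
    finally show ?thesis
      by (simp add: Q_def cinner.diff_left cinner_self power2_eq_square mult_right_mono)
  qed
  have "self_adjoint Q"
    unfolding self_adjoint_def
    by (rule adj_on_eqI) (use Q_ops in \<open>simp_all add: Q_def cinner.diff_left cinner.diff_right Y_sym\<close>)
  then have Q: "positive_op Q"
    using Q_ops Q_pos by (simp add: positive_op_def op_le_def cinner.zero_left)
  have QQ: "Q (Q x) = A x" for x
  proof -
    have "2 *\<^sub>R Y x = B x + Y (Y x)"
      by (subst Y(3)) (simp add: blinfun.bilinear_simps)
    then show ?thesis
      by (simp add: Q_def B blinfun.diff_right scaleR_2 algebra_simps)
  qed
  have "op_abs C = Q"
    unfolding op_abs_def op_sqrt_def A_def[symmetric]
  proof (rule the_equality)
    show "positive_op Q \<and> Q \<circ> Q = A"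
      using Q QQ by auto
    fix P assume P: "positive_op P \<and> P \<circ> P = A"
    then have PP: "P (P x) = A x" for x
      by (metis comp_apply)
    interpret P: bounded_linear P
      using P by (simp add: positive_op_def bounded_ops_UNIV_iff)
    \<comment> \<open>Any root \<open>P\<close> commutes with its own square \<open>A\<close>, hence
      with \<open>Y\<close> and \<open>Q\<close>; this supplies the commutation hypothesis of
      \<open>positive_sqrt_unique\<close>.\<close>
    have "A (P x) = P (A x)" for x
      by (simp add: PP[symmetric])
    then have "P (Q x) = Q (P x)" for x
      using Y_comm[OF P.bounded_linear_axioms, of x] by (simp add: Q_def P.diff)
    then show "P = Q"
      using P Q by (intro positive_sqrt_unique) (auto simp: PP QQ)
  qed
  with Q QQ show ?thesis
    unfolding A_def by auto
qed

text \<open>A positive operator has no eigenvalue -1: since \<open>P (P x) = x\<close>, the vector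
  \<open>d = P x - x\<close> satisfies \<open>P d = - d\<close>, so positivity forces
  \<open>d = 0\<close>.\<close>

lemma op_abs_unit:
  fixes C :: "'a::chilbert_space \<Rightarrow> 'a"
  assumes C: "C \<in> bounded_ops UNIV" and le: "\<And>x. norm (C x) \<le> norm x"
    and x: "adj C (C x) = x"
  shows "op_abs C x = x"
proof -
  define P where "P = op_abs C"
  have P: "positive_op P" and "P \<circ> P = adj C \<circ> C"
    unfolding P_def using positive_op_op_abs_contraction[OF C le] by auto
  then have PPx: "P (P x) = x"
    using x by (metis comp_apply)
  interpret P: bounded_linear P
    using P by (simp add: positive_op_def bounded_ops_UNIV_iff)
  define d where "d = P x - x"
  have "P d = - d"
    by (simp add: d_def P.diff PPx)
  moreover have "0 \<le> Re (cinner (P d) d)"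
    using P by (simp add: positive_op_def op_le_def cinner.zero_left)
  ultimately have "d = 0"
    by (simp add: cinner.minus_left cinner_self)
  then show ?thesis by (simp add: P_def d_def)
qed

lemma norm_op_abs:
  fixes C :: "'a::chilbert_space \<Rightarrow> 'a"
  assumes C: "C \<in> bounded_ops UNIV" and le: "\<And>x. norm (C x) \<le> norm x"
  shows "norm (op_abs C x) = norm (C x)"
proof -
  define P where "P = op_abs C"
  have P: "positive_op P" and "P \<circ> P = adj C \<circ> C"
    unfolding P_def using positive_op_op_abs_contraction[OF C le] by auto
  then have "cinner (P x) (P x) = cinner (C x) (C x)"
    by (metis comp_apply positive_op_symmetric cinner_adj[OF C])
  then have "(norm (P x))\<^sup>2 = (norm (C x))\<^sup>2"
    by (simp only: cinner_self of_real_eq_iff)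
  then show ?thesis by (simp add: P_def)
qed

lemma
  fixes T :: "'a::chilbert_space \<Rightarrow> 'a"
  assumes T: "T \<in> bounded_ops UNIV"
  shows op_Re_bounded_ops: "op_Re T \<in> bounded_ops UNIV"
    and adj_op_Re: "adj (op_Re T) = op_Re T"
proof -
  have T': "adj T \<in> bounded_ops UNIV" by (rule adj_bounded_ops[OF T])
  have "bounded_linear (\<lambda>x. (1/2) *\<^sub>C (T x + adj T x))"
    using T T' by (intro bounded_linear_compose[OF bounded_linear_scaleC] bounded_linear_add)
      (simp_all add: bounded_ops_UNIV_iff)
  then show ops: "op_Re T \<in> bounded_ops UNIV"
    using T T' by (simp add: bounded_ops_UNIV_iff op_Re_def scaleC_add_right scaleC_scaleC mult.commute)
  show "adj (op_Re T) = op_Re T"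
    by (rule adj_on_eqI)
      (use ops in \<open>simp_all add: op_Re_def cinner_scaleC_left cinner_scaleC_right cinner_add_left
        cinner_add_right cinner_adj[OF T] cinner_adj'[OF T] add.commute\<close>)
qed

section \<open>Quasi-isometries\<close>

text \<open>Equality case of Cauchy-Schwarz: \<open>adj T (T x)\<close> is no longer than
  \<open>x\<close>, yet its inner product with \<open>x\<close> is the full square of
  \<open>norm x\<close>.\<close>

lemma isometric_vector_fixed:
  fixes T :: "'a::chilbert_space \<Rightarrow> 'a"
  assumes T: "T \<in> bounded_ops UNIV" and le: "\<And>x. norm (T x) \<le> norm x"
    and x: "norm (T x) = norm x"
  shows "adj T (T x) = x"
proof -
  have "Re (cinner (adj T (T x)) x) = (norm x)\<^sup>2"
    by (simp add: cinner_adj'[OF T] cinner_self x)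
  moreover have "(norm (adj T (T x)))\<^sup>2 \<le> (norm x)\<^sup>2"
    using norm_adj_le[OF T le, of "T x"] x by (intro power_mono) auto
  ultimately have "(norm (adj T (T x) + - x))\<^sup>2 \<le> 0"
    unfolding norm_add_power2 by (simp add: cinner.minus_right)
  then show ?thesis by simp
qed

text \<open>The order hypothesis enters the development only here, evaluated at the single vector
  \<open>x\<close>.\<close>

lemma abs_le_abs_Re_fixed:
  fixes T :: "'a::chilbert_space \<Rightarrow> 'a"
  assumes T: "T \<in> bounded_ops UNIV" and le: "\<And>x. norm (T x) \<le> norm x"
    and abs: "op_le (op_abs T) (op_abs (op_Re T))"
    and x: "adj T (T x) = x"
  shows "adj T x = T x" and "T (T x) = x"
proof -
  define R where "R = op_Re T"
  have Rx: "R z = (1/2) *\<^sub>R (T z + adj T z)" for z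
    using scaleC_of_real[of "1/2"] by (simp add: R_def op_Re_def)
  have R: "R \<in> bounded_ops UNIV" and adj_R: "adj R = R"
    unfolding R_def by (rule op_Re_bounded_ops[OF T] adj_op_Re[OF T])+
  have R_le: "norm (R z) \<le> norm z" for z
    using norm_triangle_ineq[of "T z" "adj T z"] le[of z] norm_adj_le[OF T le, of z]
    by (simp add: Rx)
  have "(norm x)\<^sup>2 = Re (cinner (op_abs T x) x)"
    using op_abs_unit[OF T le x] by (simp add: cinner_self)
  also have "\<dots> \<le> Re (cinner (op_abs R x) x)"
    using abs by (simp add: op_le_def R_def)
  finally have "(norm x)\<^sup>2 \<le> Re (cinner (op_abs R x) x)" .
  \<comment> \<open>Together with the preceding lower bound this is again the equality case of
    Cauchy-Schwarz, now for \<open>op_abs R x\<close> and \<open>x\<close>.\<close>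
  moreover have "(norm (op_abs R x))\<^sup>2 \<le> (norm x)\<^sup>2"
    by (intro power_mono) (simp_all add: norm_op_abs[OF R R_le] R_le)
  ultimately have "(norm (op_abs R x + - x))\<^sup>2 \<le> 0"
    by (simp only: norm_add_power2 cinner.minus_right norm_minus_cancel uminus_complex.sel)
  then have abs_R: "op_abs R x = x" by simp
  have "op_abs R (op_abs R x) = adj R (R x)"
    using positive_op_op_abs_contraction[OF R R_le] by (metis comp_apply)
  then have RR: "R (R x) = x"
    by (simp add: abs_R adj_R)
  have "norm (R x) = norm x"
    using norm_op_abs[OF R R_le, of x] abs_R by simp
  then have "norm (T x + adj T x) = 2 * norm x"
    by (simp add: Rx)
  then have "(norm (T x + adj T x))\<^sup>2 = 4 * (norm x)\<^sup>2"
    by (simp add: power_mult_distrib)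
  \<comment> \<open>Parallelogram law: the sum already exhausts the largest possible right-hand
    side, leaving nothing for the difference.\<close>
  moreover have "(norm (T x + adj T x))\<^sup>2 + (norm (T x - adj T x))\<^sup>2
      = 2 * (norm (T x))\<^sup>2 + 2 * (norm (adj T x))\<^sup>2"
    using norm_add_power2[of "T x" "adj T x"] norm_add_power2[of "T x" "- adj T x"]
    by (simp add: cinner.minus_right)
  moreover have "(norm (T x))\<^sup>2 \<le> (norm x)\<^sup>2" "(norm (adj T x))\<^sup>2 \<le> (norm x)\<^sup>2"
    by (intro power_mono; simp add: le norm_adj_le[OF T le])+
  ultimately have "(norm (T x - adj T x))\<^sup>2 \<le> 0"
    by linarith
  then show eq: "adj T x = T x" by simp
  then have "R x = T x"
    by (simp add: Rx scaleR_2[symmetric])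
  \<comment> \<open>Here \<open>x\<close> stands for \<open>adj T (T x)\<close>, so the left side is
    \<open>2 *\<^sub>R R (T x)\<close>, which equals \<open>2 *\<^sub>R R (R x)\<close>.\<close>
  then have "T (T x) + x = 2 *\<^sub>R x"
    using RR x Rx[of "T x"] by (metis scaleR_half_double scaleR_right_imp_eq scaleR_2 scaleR_add_right)
  then show "T (T x) = x"
    by (simp add: scaleR_2)
qed

text \<open>Shifting one factor \<open>T\<close> across the inner product lowers the exponent: if
  \<open>n = Suc k\<close>, the squared norm of \<open>(T ^^ n) x\<close> pairs
  \<open>(T ^^ k) x\<close> with \<open>(T ^^ Suc n) x = 0\<close>.\<close>

lemma self_adjoint_funpow_zero:
  fixes T :: "'a::chilbert_space \<Rightarrow> 'a"
  assumes T: "T \<in> bounded_ops UNIV" and sa: "self_adjoint T"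
    and "(T ^^ n) x = 0"
  shows "T x = 0"
  using assms(3)
proof (induction n)
  case 0
  then show ?case
    using T by (simp add: bounded_ops_UNIV_iff bounded_linear.linear linear_0)
next
  case (Suc n)
  show ?case
  proof (cases n)
    case 0
    with Suc show ?thesis by simp
  next
    case (Suc k)
    have "cinner ((T ^^ n) x) ((T ^^ n) x) = cinner ((T ^^ k) x) (adj T ((T ^^ n) x))"
      using cinner_adj[OF T] by (simp add: Suc)
    also have "\<dots> = 0"
      using Suc.prems sa by (simp add: self_adjoint_def cinner.zero_right)
    finally show ?thesis
      using Suc.IH by (simp add: cinner_self)
  qed
qed

section \<open>Powers, null spaces and direct sums\<close>

lemma cinner_funpow_adj:
  fixes T :: "'a::chilbert_space \<Rightarrow> 'a"
  assumes "T \<in> bounded_ops UNIV"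
  shows "cinner ((T ^^ n) x) y = cinner x ((adj T ^^ n) y)"
  by (induction n arbitrary: x y) (simp_all add: cinner_adj[OF assms] funpow_swap1)

lemma bounded_ops_UNIV_funpow:
  assumes "T \<in> bounded_ops UNIV"
  shows "T ^^ n \<in> bounded_ops UNIV"
  using assms unfolding bounded_ops_UNIV_iff
  by (induction n) (auto simp: id_def comp_def intro: bounded_linear_ident bounded_linear_compose)

lemma
  assumes "T \<in> bounded_ops UNIV"
  shows csubspace_null_space: "csubspace (null_space T)"
    and closed_null_space: "closed (null_space T)"
proof -
  interpret T: bounded_linear T
    using assms by (simp add: bounded_ops_UNIV_iff)
  show "csubspace (null_space T)"
    using assms by (simp add: csubspace_def null_space_def T.zero T.add bounded_ops_UNIV_iff)
  have "closed (T -` {0})"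
    by (intro continuous_closed_vimage closed_singleton continuous_intros T.continuous)
  then show "closed (null_space T)"
    by (simp add: null_space_def vimage_def)
qed

text \<open>Components are unique: \<open>g - g' = k' - k\<close> lies in both subspaces and is
  therefore orthogonal to itself.\<close>

lemma op_direct_sum_eq:
  assumes dec: "orthogonal_decomposition G K" and "g \<in> G" "k \<in> K"
  shows "op_direct_sum G K A B (g + k) = A g + B k"
  unfolding op_direct_sum_def
proof (rule the_equality)
  fix y assume "\<exists>g'\<in>G. \<exists>k'\<in>K. g + k = g' + k' \<and> y = A g' + B k'"
  then obtain g' k' where gk: "g' \<in> G" "k' \<in> K" "g + k = g' + k'" and y: "y = A g' + B k'"
    by blast
  have "g + (- 1) *\<^sub>C g' \<in> G" "k' + (- 1) *\<^sub>C k \<in> K"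
    using assms gk unfolding orthogonal_decomposition_def csubspace_def by blast+
  then have "cinner (g - g') (k' - k) = 0"
    using dec by (simp add: orthogonal_decomposition_def)
  moreover have "k' - k = g - g'"
    using gk(3) by (simp add: algebra_simps)
  ultimately have "g = g'"
    by (simp add: cinner_self)
  with gk(3) y show "y = A g + B k" by simp
qed (use assms in blast)

theorem corollary3p5:
  fixes T :: "'a::chilbert_space \<Rightarrow> 'a" and m :: nat
  assumes "T \<in> bounded_ops UNIV"
    and "contractive T"
    and "m \<ge> 3"
    and "quasi_isometry m T"
    and "op_le (op_abs T) (op_abs (op_Re T))"
  shows "null_space (\<lambda>x. x - adj T (T x)) = null_space (\<lambda>x. x - T (adj T x))
    \<and> null_space (\<lambda>x. x - T (adj T x)) = closure (range (T ^^ m))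
    \<and> reduces_to_symmetry (closure (range (T ^^ m))) T
    \<and> orthogonal_decomposition (closure (range (T ^^ m))) (null_space (adj T ^^ m))
    \<and> (self_adjoint T \<longleftrightarrow>
        T = op_direct_sum (closure (range (T ^^ m))) (null_space (adj T ^^ m))
              (restrict T (closure (range (T ^^ m))))
              (restrict (\<lambda>_. 0) (null_space (adj T ^^ m))))"
proof -
  note T = assms(1)
  interpret T: bounded_linear T
    using T by (simp add: bounded_ops_UNIV_iff)
  have TC: "T (c *\<^sub>C x) = c *\<^sub>C T x" for c x
    using T by (simp add: bounded_ops_UNIV_iff)
  have T': "adj T \<in> bounded_ops UNIV"
    by (rule adj_bounded_ops[OF T])
  interpret T': bounded_linear "adj T"
    using T' by (simp add: bounded_ops_UNIV_iff)
  have T'C: "adj T (c *\<^sub>C x) = c *\<^sub>C adj T x" for c x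
    using T' by (simp add: bounded_ops_UNIV_iff)
  have le: "norm (T x) \<le> norm x" for x
    using onorm[OF T.bounded_linear_axioms, of x] assms(2)
      mult_right_mono[of "onorm T" 1 "norm x"] by (simp add: contractive_def)
  define N where "N = null_space (\<lambda>x. x - adj T (T x))"
  define K where "K = null_space (adj T ^^ m)"
  have N_iff: "x \<in> N \<longleftrightarrow> adj T (T x) = x" for x
    by (auto simp: N_def null_space_def)
  have fixed: "adj T x = T x" "T (T x) = x" if "x \<in> N" for x
    using that unfolding N_iff by (rule abs_le_abs_Re_fixed[OF T le assms(5)])+
  have T_N: "T x \<in> N" if "x \<in> N" for x
    using fixed[OF that] by (simp add: N_iff)
  have Tpow_N: "(T ^^ n) x \<in> N" if "x \<in> N" for n x
    by (induction n) (use that T_N in auto)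
  have adj_pow_N: "(adj T ^^ n) x = (T ^^ n) x" if "x \<in> N" for n x
    by (induction n) (use that Tpow_N fixed in auto)
  \<comment> \<open>The exponent is written \<open>n + n\<close> so that \<open>funpow_add\<close>
    splits it into two equal powers.\<close>
  have even_pow_N: "(T ^^ (n + n)) x = x" if "x \<in> N" for n x
    by (induction n) (use that fixed in \<open>auto simp: funpow_swap1\<close>)
  \<comment> \<open>The range itself, before taking closures, is a null space and hence already
    closed.\<close>
  have range_N: "range (T ^^ m) = N"
  proof
    show "range (T ^^ m) \<subseteq> N"
    proof
      fix y assume "y \<in> range (T ^^ m)"
      then have "norm (T y) = norm y"
        using assms(4) unfolding quasi_isometry_def by blast
      then show "y \<in> N"
        unfolding N_iff by (rule isometric_vector_fixed[OF T le])
    qed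
    show "N \<subseteq> range (T ^^ m)"
    proof
      fix x assume "x \<in> N"
      then have "x = (T ^^ m) ((T ^^ m) x)"
        using even_pow_N[of x m] by (simp add: funpow_add)
      then show "x \<in> range (T ^^ m)" by (rule range_eqI)
    qed
  qed
  have "(\<lambda>x. x - adj T (T x)) \<in> bounded_ops UNIV"
    unfolding bounded_ops_UNIV_iff
    by (intro conjI allI bounded_linear_sub bounded_linear_ident
        bounded_linear_compose[OF T'.bounded_linear_axioms T.bounded_linear_axioms])
      (simp add: TC T'C bounded_linear.linear[OF bounded_linear_scaleC, THEN linear_diff])
  then have sub_N: "csubspace N" and closed_N: "closed N"
    unfolding N_def by (rule csubspace_null_space closed_null_space)+
  have clos: "closure (range (T ^^ m)) = N"
    using range_N closed_N by simp
  \<comment> \<open>\<open>T\<close> attains its norm at \<open>adj T x\<close>, which therefore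
    lies in \<open>N\<close>; then so does its image \<open>x\<close> under
    \<open>T\<close>.\<close>
  have "x \<in> N" if x: "T (adj T x) = x" for x
  proof -
    have "norm x \<le> norm (adj T x)"
      using le[of "adj T x"] x by simp
    then have "norm (T (adj T x)) = norm (adj T x)"
      using norm_adj_le[OF T le, of x] x by simp
    then have "adj T x \<in> N"
      using isometric_vector_fixed[OF T le] by (simp add: N_iff)
    from T_N[OF this] x show ?thesis by simp
  qed
  moreover have "T (adj T x) = x" if "x \<in> N" for x
    using fixed[OF that] by simp
  ultimately have N2: "null_space (\<lambda>x. x - T (adj T x)) = N"
    unfolding null_space_def by fastforce
  define S where "S = restrict T N"
  have S_ops: "S \<in> bounded_ops N"
    using sub_N T.bounded T_N by (auto simp: S_def bounded_ops_def csubspace_def T.add TC)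
  \<comment> \<open>The adjoint relative to \<open>N\<close> is computed from the global one, which
    agrees with \<open>T\<close> on \<open>N\<close>.\<close>
  have adj_S: "adj_on N S = S"
    by (rule adj_on_eqI[OF sub_N S_ops]) (simp add: S_def cinner_adj[OF T] fixed)
  have symm: "symmetry_on N S"
    unfolding symmetry_on_def unitary_on_def adj_S
    using S_ops by (simp add: S_def fixed T_N)
  have red: "reduces_to_symmetry N T"
    using sub_N closed_N symm T_N fixed by (auto simp: reduces_to_symmetry_def S_def)
  have adj_pow: "adj T ^^ m \<in> bounded_ops UNIV"
    by (rule bounded_ops_UNIV_funpow[OF T'])
  have orth: "cinner g k = 0" if "g \<in> N" "k \<in> K" for g k
    using that range_N cinner_funpow_adj[OF T, of m]
    by (auto simp: K_def null_space_def cinner.zero_right)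
  have dec: "\<exists>g\<in>N. \<exists>k\<in>K. x = g + k" for x
  proof (intro bexI)
    \<comment> \<open>The witness is the projection of \<open>x\<close> onto \<open>N\<close>: it
      lies in the range of \<open>T ^^ m\<close>, and pairing it with \<open>u\<close> in
      \<open>N\<close> moves \<open>adj T ^^ (m + m)\<close> onto \<open>u\<close>, where that power
      is the identity.\<close>
    let ?g = "(T ^^ (m + m)) x"
    show g: "?g \<in> N"
      using range_N by (auto simp: funpow_add)
    have "cinner y ((adj T ^^ m) (x - ?g)) = 0" for y
    proof -
      define u where "u = (T ^^ m) y"
      have u: "u \<in> N"
        using range_N by (auto simp: u_def)
      have "cinner ?g u = cinner x u"
        by (simp only: cinner_funpow_adj[OF T] adj_pow_N[OF u] even_pow_N[OF u])
      then have "cinner u ?g = cinner u x"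
        by (metis cinner_commute)
      then show ?thesis
        by (simp add: cinner_funpow_adj[OF T, symmetric] u_def[symmetric] cinner.diff_right)
    qed
    then have "(adj T ^^ m) (x - ?g) = 0"
      by (rule cinner_ext_right[where z = 0, unfolded cinner.zero_right])
    then show "x - ?g \<in> K"
      by (simp add: K_def null_space_def)
  qed simp
  have decomp: "orthogonal_decomposition N K"
    unfolding orthogonal_decomposition_def
    using sub_N closed_N csubspace_null_space[OF adj_pow] closed_null_space[OF adj_pow] orth dec
    by (simp add: K_def)
  have sum_eq: "op_direct_sum N K S (restrict (\<lambda>_. 0) K) (g + k) = T g"
    if "g \<in> N" "k \<in> K" for g k
    using op_direct_sum_eq[OF decomp that] that by (simp add: S_def)
  have "self_adjoint T \<longleftrightarrow> T = op_direct_sum N K S (restrict (\<lambda>_. 0) K)"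
  proof
    assume sa: "self_adjoint T"
    show "T = op_direct_sum N K S (restrict (\<lambda>_. 0) K)"
    proof
      fix x
      obtain g k where gk: "g \<in> N" "k \<in> K" "x = g + k"
        using dec by blast
      \<comment> \<open>Self-adjointness turns \<open>K\<close> into the null space of
        \<open>T ^^ m\<close>, and then of \<open>T\<close> itself.\<close>
      have "(T ^^ m) k = 0"
        using gk sa by (simp add: K_def null_space_def self_adjoint_def)
      then have "T k = 0"
        by (rule self_adjoint_funpow_zero[OF T sa])
      then show "T x = op_direct_sum N K S (restrict (\<lambda>_. 0) K) x"
        using gk sum_eq by (simp add: T.add)
    qed
  next
    assume eq: "T = op_direct_sum N K S (restrict (\<lambda>_. 0) K)"
    \<comment> \<open>Both sides see only the components in \<open>N\<close>: \<open>T\<close>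
      depends on these alone and maps them into \<open>N\<close>, orthogonally to
      \<open>K\<close>.\<close>
    have "cinner (T x) y = cinner x (T y)" for x y
    proof -
      obtain g k where gk: "g \<in> N" "k \<in> K" "x = g + k"
        using dec by blast
      obtain h l where hl: "h \<in> N" "l \<in> K" "y = h + l"
        using dec by blast
      have "cinner k (T h) = 0"
        using orth[OF T_N[OF hl(1)] gk(2)] by (subst cinner_commute) simp
      moreover have "T x = T g" "T y = T h"
        using eq gk hl sum_eq by metis+
      ultimately show ?thesis
        using gk hl orth[OF T_N[OF gk(1)] hl(2)] fixed(1)[OF hl(1)] cinner_adj[OF T, of g h]
        by (simp add: cinner_add_left cinner_add_right)
    qed
    then show "self_adjoint T"
      unfolding self_adjoint_def using T by (intro adj_on_eqI) auto
  qed
  then show ?thesis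
    using N2 red decomp unfolding clos N_def[symmetric] K_def[symmetric] S_def by simp
qed

end
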